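(* Let $(\boldsymbol{x}_k,\boldsymbol{w}_k,\boldsymbol{z}_k,\boldsymbol{\mu}_k)$ be the iterates of the centralized ADMM algorithm described in the context. Then at each iteration $k\ge 0$ the $\boldsymbol{z}$-update problem $$\underset{\boldsymbol{z}\in\mathcal{Z}}{\arg\min}\ \|\boldsymbol{z}-\boldsymbol{w}_{k+1}+\boldsymbol{\mu}_k\|^2$$ is equivalent (i.e. has the same set of minimizers) to the discrete linear optimization problem $$\underset{\boldsymbol{z}\in\mathcal{Z}}{\arg\min}\ \boldsymbol{z}^{\top}\boldsymbol{h}_k,$$ where the weight vector $\boldsymbol{h}_k\in\mathbb{R}^m$ is given by $\boldsymbol{h}_k=\boldsymbol{\mu}_k-\boldsymbol{w}_{k+1}$.
   Context: Let $(\mathcal{V},\mathcal{E})$ be an undirected graph (respectively, let $(\mathcal{V},\mathcal{A})$ be a directed graph with a designated root node $r\in\mathcal{V}$), with $|\mathcal{V}|=n$ vertices and $m$ edges (respectively $m$ arcs). Vectors in $\mathbb{R}^m$ appearing below as $\boldsymbol{z},\boldsymbol{w},\boldsymbol{\mu},\boldsymbol{h}$ are indexed by the edges (arcs), and $\|\cdot\|$ is the Euclidean norm. The set $\mathcal{Z}\subset\{0,1\}^m$ consists of all binary vectors $\boldsymbol{z}$ such that the set of edges (arcs) $(i,j)$ with $z_{ij}=1$ is a spanning tree of $(\mathcal{V},\mathcal{E})$ in the undirected case (a connected acyclic subgraph containing all vertices), respectively a spanning arborescence of $(\mathcal{V},\mathcal{A})$ rooted at $r$ in the directed case (a directed spanning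 tree containing a unique directed path from $r$ to every other node). Let $\mathcal{X}\subseteq\mathbb{R}^m$, and let $f:\mathcal{X}\times[0,1]^m\to\mathbb{R}$ and $g:\mathcal{X}\times[0,1]^m\to\mathbb{R}^q$ be jointly convex functions. Put $\Sigma=\{(\boldsymbol{x},\boldsymbol{w})\in\mathcal{X}\times[0,1]^m : g(\boldsymbol{x},\boldsymbol{w})\le \boldsymbol{0}_q\}$, assumed nonempty. Fix a penalty parameter $\rho>0$. The centralized ADMM algorithm, started from some initial $\boldsymbol{z}_0,\boldsymbol{\mu}_0$, has the updates, for $k\ge 0$, $$(\boldsymbol{x},\boldsymbol{w})_{k+1}=\underset{(\boldsymbol{x},\boldsymbol{w})\in\Sigma}{\arg\min}\Big[f(\boldsymbol{x},\boldsymbol{w})+\frac{\rho}{2}\|\boldsymbol{z}_k-\boldsymbol{w}+\boldsymbol{\mu}_k\|^2\Big],$$ $$\boldsymbol{z}_{k+1}=\underset{\boldsymbol{z}\in\mathcal{Z}}{\arg\min}\ \|\boldsymbol{z}-\boldsymbol{w}_{k+1}+\boldsymbol{\mu}_k\|^2,$$ $$\boldsymbol{\mu}_{k+1}=\boldsymbol{\mu}_k+\boldsymbol{z}_{k+1}-\boldsymbol{w}_{k+1}.$$ Here "$=\arg\min$" in an update means that a minimizer is chosen. *)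

theory Defs
  imports "HOL-Analysis.Analysis" "Graph_Theory.Digraph_Component"
begin

section \<open>Spanning trees and spanning arborescences\<close>

text \<open>
  Undirected graphs are symmetric digraphs, as in \<^theory>\<open>Graph_Theory.Digraph\<close>.  An undirected
  edge stands for the two opposite arcs and is represented by the set of its ends, so that it
  is counted (and indexed by vectors) once; a loop would be a singleton.
\<close>

definition undirected_edges :: "('v \<times> 'v) set \<Rightarrow> 'v set set" where
  "undirected_edges A = (\<lambda>(u, v). {u, v}) ` A"

definition edge_graph :: "'v set \<Rightarrow> 'v set set \<Rightarrow> 'v pair_pre_digraph" where
  "edge_graph V T = \<lparr> pverts = V, parcs = {(u, v). {u, v} \<in> T} \<rparr>"

text \<open>
  The constant \<open>tree\<close> of \<^theory>\<open>Graph_Theory.Digraph_Component\<close> is not used: it forbids only directed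
  cycles, so an orientation of an undirected cycle may be a tree, whereas a symmetric digraph
  with an arc never is one.  In the symmetric digraph \<open>edge_graph V T\<close> the cycles of length 2
  are exactly those that traverse one edge back and forth; all others (loops, and cycles of
  length at least 3) are the cycles of the undirected graph \<open>(V, T)\<close>.
\<close>

definition undirected_tree :: "'v set \<Rightarrow> 'v set set \<Rightarrow> bool" where
  "undirected_tree V T \<longleftrightarrow>
     Digraph_Component.connected (with_proj (edge_graph V T)) \<and>
     \<not> (\<exists>p. pre_digraph.cycle (with_proj (edge_graph V T)) p \<and> length p \<noteq> 2)"

definition is_spanning_tree :: "'v pair_pre_digraph \<Rightarrow> 'v set set \<Rightarrow> bool" where
  "is_spanning_tree G T \<longleftrightarrow>
     T \<subseteq> undirected_edges (parcs G) \<and> undirected_tree (pverts G) T"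

text \<open>
  A directed spanning tree is an orientation of an undirected one: no loops, no pair of opposite
  arcs, and forgetting directions leaves a tree.
\<close>

definition is_spanning_arborescence ::
    "'v pair_pre_digraph \<Rightarrow> 'v \<Rightarrow> ('v \<times> 'v) set \<Rightarrow> bool" where
  "is_spanning_arborescence G r B \<longleftrightarrow>
     B \<subseteq> parcs G \<and> B \<inter> B\<inverse> = {} \<and> undirected_tree (pverts G) (undirected_edges B) \<and>
     (\<forall>v \<in> pverts G - {r}.
        \<exists>!p. pre_digraph.apath (with_proj \<lparr> pverts = pverts G, parcs = B \<rparr>) r p v)"


section \<open>Vectors indexed by a set of edges or arcs\<close>

text \<open>
  For a graph with edge (arc) set \<open>E\<close>, \<open>\<real>\<^sup>m\<close> with \<open>m = card E\<close> is the coordinate subspace of the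
  vectors vanishing outside \<open>E\<close>.  Its norm and inner product are the Euclidean ones of \<open>\<real>\<^sup>m\<close>.
\<close>

definition coord_space :: "'e set \<Rightarrow> (real ^ 'e::finite) set" where
  "coord_space E = {z. \<forall>e. e \<notin> E \<longrightarrow> z $ e = 0}"

definition unit_cube :: "'e set \<Rightarrow> (real ^ 'e::finite) set" where
  "unit_cube E = {z \<in> coord_space E. \<forall>e\<in>E. 0 \<le> z $ e \<and> z $ e \<le> 1}"

definition binary_vectors :: "'e set \<Rightarrow> ('e set \<Rightarrow> bool) \<Rightarrow> (real ^ 'e::finite) set" where
  "binary_vectors E P =
     {z \<in> coord_space E. (\<forall>e\<in>E. z $ e \<in> {0, 1}) \<and> P {e \<in> E. z $ e = 1}}"

definition spanning_tree_vectors :: "'v::finite pair_pre_digraph \<Rightarrow> (real ^ ('v set)) set" where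
  "spanning_tree_vectors G =
     binary_vectors (undirected_edges (parcs G)) (is_spanning_tree G)"

definition arborescence_vectors ::
    "'v::finite pair_pre_digraph \<Rightarrow> 'v \<Rightarrow> (real ^ ('v \<times> 'v)) set" where
  "arborescence_vectors G r = binary_vectors (parcs G) (is_spanning_arborescence G r)"


section \<open>Centralized ADMM\<close>

text \<open>The map \<open>g\<close> into \<open>\<real>\<^sup>q\<close> is given by its components \<open>\<lambda>p. g p i\<close> for \<open>i < q\<close>.\<close>

definition feasible_set ::
    "'e set \<Rightarrow> (real ^ 'e::finite) set \<Rightarrow> nat \<Rightarrow>
     ((real ^ 'e) \<times> (real ^ 'e) \<Rightarrow> nat \<Rightarrow> real) \<Rightarrow> ((real ^ 'e) \<times> (real ^ 'e)) set" where
  "feasible_set E X q g = {p \<in> X \<times> unit_cube E. \<forall>i<q. g p i \<le> 0}"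

definition argmin_set :: "('a \<Rightarrow> real) \<Rightarrow> 'a set \<Rightarrow> 'a set" where
  "argmin_set F S = {a. is_arg_min F (\<lambda>b. b \<in> S) a}"

text \<open>
  Convexity of \<open>f\<close> and \<open>g\<close> includes convexity of their domain \<open>X \<times> [0,1]\<^sup>m\<close>.  The values \<open>x 0\<close> and
  \<open>w 0\<close> play no role in the iteration and are left unconstrained.
\<close>

locale centralized_admm =
  fixes E :: "'e::finite set"
    and Z :: "(real ^ 'e) set"
    and X :: "(real ^ 'e) set"
    and f :: "(real ^ 'e) \<times> (real ^ 'e) \<Rightarrow> real"
    and q :: nat
    and g :: "(real ^ 'e) \<times> (real ^ 'e) \<Rightarrow> nat \<Rightarrow> real"
    and \<rho> :: real
    and x w z \<mu> :: "nat \<Rightarrow> real ^ 'e"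
  assumes X_subset: "X \<subseteq> coord_space E"
    and f_convex: "convex_on (X \<times> unit_cube E) f"
    and g_convex: "\<And>i. i < q \<Longrightarrow> convex_on (X \<times> unit_cube E) (\<lambda>p. g p i)"
    and feasible_nonempty: "feasible_set E X q g \<noteq> {}"
    and rho_pos: "\<rho> > 0"
    and z_init: "z 0 \<in> coord_space E"
    and mu_init: "\<mu> 0 \<in> coord_space E"
    and xw_update: "\<And>k. (x (Suc k), w (Suc k)) \<in>
          argmin_set (\<lambda>(x', w'). f (x', w') + \<rho> / 2 * (norm (z k - w' + \<mu> k))\<^sup>2)
            (feasible_set E X q g)"
    and z_update: "\<And>k. z (Suc k) \<in>
          argmin_set (\<lambda>z'. (norm (z' - w (Suc k) + \<mu> k))\<^sup>2) Z"
    and mu_update: "\<And>k. \<mu> (Suc k) = \<mu> k + z (Suc k) - w (Suc k)"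

end

theory Submission
  imports Defs
begin

text \<open>
  All spanning trees (arborescences) of a graph on \<open>n\<close> vertices have \<open>n - 1\<close> edges (arcs), so the
  squared norm of \<open>\<zeta>\<close> is the constant \<open>n - 1\<close> on the set of their characteristic vectors.  Hence,
  in the expansion of the squared norm of \<open>\<zeta> + h\<close>, only the cross term \<open>2 (\<zeta> \<bullet> h)\<close> depends on \<open>\<zeta>\<close>.
\<close>

section \<open>Number of edges of a tree\<close>

lemma edge_graph_simps [simp]:
  "pverts (edge_graph V T) = V"
  "(u, v) \<in> parcs (edge_graph V T) \<longleftrightarrow> {u, v} \<in> T"
  by (auto simp: edge_graph_def)

lemma sym_edge_graph: "sym (parcs (edge_graph V T))"
  by (auto simp: sym_def insert_commute)

lemma pair_wf_digraph_edge_graph: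
  assumes "T \<subseteq> Pow V"
  shows "pair_wf_digraph (edge_graph V T)"
  using assms by unfold_locales auto

lemma undirected_tree_nonempty: "undirected_tree V T \<Longrightarrow> V \<noteq> {}"
  by (auto simp: undirected_tree_def connected_def strongly_connected_def)

text \<open>\<open>connected\<close> speaks of the symmetric closure of a digraph, which adds no
  arcs here because \<open>edge_graph\<close> is symmetric already.\<close>

lemma undirected_tree_reachable:
  assumes "undirected_tree V T" "u \<in> V" "v \<in> V"
  shows "(u, v) \<in> (parcs (edge_graph V T))\<^sup>*"
proof -
  have arcs: "parcs (mk_symmetric (with_proj (edge_graph V T))) = parcs (edge_graph V T)"
    by (auto simp: parcs_mk_symmetric insert_commute)
  have "reachable (with_proj (mk_symmetric (with_proj (edge_graph V T)))) u v"
    using assms by (auto simp: undirected_tree_def connected_def strongly_connected_def)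
  from reachable_rtranclI[OF this] show ?thesis
    by (simp add: arcs)
qed

text \<open>A path from \<open>u\<close> to \<open>v\<close> avoiding the edge closes up with the
  arc \<open>(v, u)\<close> to a cycle. The only admissible length is 2, so the path would be the
  deleted arc \<open>(u, v)\<close> itself. For \<open>u = v\<close> the path is empty and the cycle
  is a loop, of length 1.\<close>

lemma undirected_tree_edge_is_bridge:
  assumes tree: "undirected_tree V T" and T: "T \<subseteq> Pow V" and e: "{u, v} \<in> T"
  shows "(u, v) \<notin> (parcs (edge_graph V (T - {{u, v}})))\<^sup>*"
proof
  let ?H = "edge_graph V (T - {{u, v}})"
  assume uv: "(u, v) \<in> (parcs ?H)\<^sup>*"
  interpret H: pair_wf_digraph ?H
    using T by (intro pair_wf_digraph_edge_graph) auto
  interpret G: pair_wf_digraph "edge_graph V T"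
    using T by (rule pair_wf_digraph_edge_graph)
  have V: "u \<in> V" "v \<in> V"
    using T e by auto
  have "reachable (with_proj ?H) u v"
    unfolding reachable_def using uv V
    by (auto intro!: rtrancl_consistent_rtrancl_on dest: H.in_arcsD2)
  then obtain p where p: "H.apath u p v"
    by (auto simp: H.reachable_apath)
  have "G.awalk u p v"
    using p unfolding H.apath_def H.awalk_def G.awalk_def by auto
  then have "G.awalk v ((v, u) # p) v"
    using e by (simp add: G.awalk_Cons_iff insert_commute)
  \<comment> \<open>Dropping the start \<open>v\<close> leaves the vertices of the path
    \<open>p\<close>.\<close>
  moreover have "distinct (tl (G.awalk_verts v ((v, u) # p)))"
    using p by (simp add: H.apath_def)
  ultimately have "G.cycle ((v, u) # p)"
    unfolding G.cycle_def by blast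
  with tree have "length ((v, u) # p) = 2"
    unfolding undirected_tree_def by blast
  then obtain a where "p = [a]"
    by (cases p) auto
  with p have "(u, v) \<in> parcs ?H"
    by (cases a) (auto simp: H.apath_def H.awalk_def)
  then show False by simp
qed

text \<open>The \<open>LEAST\<close> terms are distances from \<open>r\<close>; \<open>p\<close> is
  the last vertex before \<open>v\<close> on a shortest walk.\<close>

lemma rtrancl_decreasing_parent:
  assumes "(r, v) \<in> R\<^sup>*" "v \<noteq> r"
  shows "\<exists>p. (p, v) \<in> R \<and> (LEAST n. (r, p) \<in> R ^^ n) < (LEAST n. (r, v) \<in> R ^^ n)"
proof -
  let ?d = "\<lambda>v. LEAST n. (r, v) \<in> R ^^ n"
  obtain m where "(r, v) \<in> R ^^ m"
    using assms(1) rtrancl_imp_relpow by blast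
  then have v: "(r, v) \<in> R ^^ ?d v"
    by (rule LeastI)
  \<comment> \<open>Distance 0 would force \<open>v = r\<close>, as \<open>R ^^ 0\<close> is the
    identity.\<close>
  with assms(2) obtain n where n: "?d v = Suc n"
    by (cases "?d v") auto
  with v obtain p where p: "(r, p) \<in> R ^^ n" "(p, v) \<in> R"
    by auto
  then have "?d p \<le> n"
    by (auto intro: Least_le)
  with n p show ?thesis
    by auto
qed

text \<open>
  Joining every vertex other than a root to a neighbour that is closer to the root is injective.
  The edges obtained connect all vertices, so every other edge would fail to be a bridge.
\<close>

lemma undirected_tree_card:
  assumes tree: "undirected_tree V T" and "finite V"
    and T: "T \<subseteq> undirected_edges (V \<times> V)"
  shows "card T = card V - 1"
proof -
  let ?R = "parcs (edge_graph V T)"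
  have T_Pow: "T \<subseteq> Pow V"
    using T by (auto simp: undirected_edges_def)
  obtain r where r: "r \<in> V"
    using undirected_tree_nonempty[OF tree] by auto
  define d where "d v = (LEAST n. (r, v) \<in> ?R ^^ n)" for v
  have "\<exists>p. {p, v} \<in> T \<and> d p < d v" if "v \<in> V - {r}" for v
    using rtrancl_decreasing_parent[of r v ?R] undirected_tree_reachable[OF tree r] that
    by (auto simp: d_def)
  then obtain parent where parent: "\<And>v. v \<in> V - {r} \<Longrightarrow> {parent v, v} \<in> T \<and> d (parent v) < d v"
    by metis
  define up where "up v = {parent v, v}" for v
  define R' where "R' = parcs (edge_graph V (up ` (V - {r})))"
  have inj: "inj_on up (V - {r})"
  proof (rule inj_onI)
    fix u v assume "u \<in> V - {r}" "v \<in> V - {r}" "up u = up v"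
    \<comment> \<open>Otherwise \<open>u\<close> and \<open>v\<close> are each other's parents, and
      each is strictly closer to \<open>r\<close> than the other.\<close>
    then show "u = v"
      using parent[of u] parent[of v] by (auto simp: up_def doubleton_eq_iff)
  qed
  have root: "(r, v) \<in> R'\<^sup>*" if "v \<in> V" for v
    using that
  \<comment> \<open>Climbing to the parent lowers the distance, so the climb ends at
    \<open>r\<close>.\<close>
  proof (induction "d v" arbitrary: v rule: less_induct)
    case less
    show ?case
    proof (cases "v = r")
      case False
      with less.prems have v: "v \<in> V - {r}" by simp
      with parent[OF v] T_Pow have "(r, parent v) \<in> R'\<^sup>*"
        by (intro less.hyps) auto
      moreover have "(parent v, v) \<in> R'"
        using v by (auto simp: R'_def up_def)
      ultimately show ?thesis ..
    qed simp
  qed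
  have "sym (R'\<^sup>*)"
    unfolding R'_def by (intro sym_rtrancl sym_edge_graph)
  then have conn: "(u, v) \<in> R'\<^sup>*" if "u \<in> V" "v \<in> V" for u v
    using that root by (meson rtrancl_trans symD)
  have "T \<subseteq> up ` (V - {r})"
  proof
    fix e assume e: "e \<in> T"
    \<comment> \<open>Only sets of this form give arcs of \<open>edge_graph\<close>, so only for
      them does the tree property exclude an extra edge.\<close>
    with T obtain u v where uv: "e = {u, v}" "u \<in> V" "v \<in> V"
      by (auto simp: undirected_edges_def)
    show "e \<in> up ` (V - {r})"
    proof (rule ccontr)
      assume "e \<notin> up ` (V - {r})"
      then have "R' \<subseteq> parcs (edge_graph V (T - {{u, v}}))"
        using parent uv by (auto simp: R'_def up_def)
      with conn[of u v] uv have "(u, v) \<in> (parcs (edge_graph V (T - {{u, v}})))\<^sup>*"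
        using rtrancl_mono by blast
      with undirected_tree_edge_is_bridge[OF tree T_Pow, of u v] e uv show False
        by simp
    qed
  qed
  moreover have "up ` (V - {r}) \<subseteq> T"
    using parent by (auto simp: up_def)
  ultimately have "T = up ` (V - {r})" ..
  \<comment> \<open>One edge for each vertex except \<open>r\<close>; since \<open>r\<close> lies in
    \<open>V\<close>, the subtraction is not truncated.\<close>
  then show ?thesis
    using inj r \<open>finite V\<close> by (simp add: card_image)
qed

lemma (in pair_wf_digraph) is_spanning_tree_card:
  assumes "finite (pverts G)" "is_spanning_tree G T"
  shows "card T = card (pverts G) - 1"
proof (rule undirected_tree_card)
  have "parcs G \<subseteq> pverts G \<times> pverts G"
    by (auto dest: in_arcsD1 in_arcsD2)
  then show "T \<subseteq> undirected_edges (pverts G \<times> pverts G)"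
    using assms(2) unfolding is_spanning_tree_def undirected_edges_def by blast
qed (use assms in \<open>auto simp: is_spanning_tree_def\<close>)

text \<open>Two arcs with the same ends are equal or opposite. As \<open>B\<close> has no opposite
  arcs, forgetting directions preserves the count.\<close>

lemma (in pair_wf_digraph) is_spanning_arborescence_card:
  assumes "finite (pverts G)" "is_spanning_arborescence G r B"
  shows "card B = card (pverts G) - 1"
proof -
  have B: "B \<subseteq> parcs G" "B \<inter> B\<inverse> = {}" "undirected_tree (pverts G) (undirected_edges B)"
    using assms(2) by (auto simp: is_spanning_arborescence_def)
  have "inj_on (\<lambda>(u, v). {u, v}) B"
    using B(2) by (auto simp: inj_on_def doubleton_eq_iff)
  then have "card B = card (undirected_edges B)"
    by (simp add: undirected_edges_def card_image)
  also have "\<dots> = card (pverts G) - 1"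
  proof (rule undirected_tree_card)
    have "B \<subseteq> pverts G \<times> pverts G"
      using B(1) by (auto dest: in_arcsD1 in_arcsD2)
    then show "undirected_edges B \<subseteq> undirected_edges (pverts G \<times> pverts G)"
      unfolding undirected_edges_def by blast
  qed (use assms B in auto)
  finally show ?thesis .
qed


section \<open>Minimization over binary vectors of constant weight\<close>

text \<open>Each entry is 0 or 1, hence its own square, and entries outside \<open>E\<close>
  vanish.\<close>

lemma binary_vectors_norm_sq:
  assumes "z \<in> binary_vectors E P"
  shows "(norm z)\<^sup>2 = real (card {e \<in> E. z $ e = 1})"
proof -
  have "(norm z)\<^sup>2 = (\<Sum>e\<in>UNIV. z $ e * z $ e)"
    by (simp add: power2_norm_eq_inner inner_vec_def)
  also have "\<dots> = (\<Sum>e\<in>UNIV. if e \<in> {e \<in> E. z $ e = 1} then 1 else 0)"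
    using assms by (intro sum.cong) (auto simp: binary_vectors_def coord_space_def)
  also have "\<dots> = real (card {e \<in> E. z $ e = 1})"
    by (subst sum.If_cases) auto
  finally show ?thesis .
qed

text \<open>\<open>is_arg_min\<close> only uses strict comparisons between values on
  \<open>S\<close>.\<close>

lemma argmin_set_cong:
  assumes "\<And>a b. a \<in> S \<Longrightarrow> b \<in> S \<Longrightarrow> F a < F b \<longleftrightarrow> H a < H b"
  shows "argmin_set F S = argmin_set H S"
  using assms by (auto simp: argmin_set_def is_arg_min_def)

text \<open>Stated for an arbitrary \<open>P\<close> of constant cardinality so that it serves trees
  and arborescences alike.\<close>

lemma argmin_set_norm_sq_eq_inner:
  fixes h :: "real ^ 'e::finite"
  assumes "\<And>B. P B \<Longrightarrow> card B = n"
  shows "argmin_set (\<lambda>z. (norm (z + h))\<^sup>2) (binary_vectors E P) =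
         argmin_set (\<lambda>z. z \<bullet> h) (binary_vectors E P)"
proof (rule argmin_set_cong)
  have "(norm (z + h))\<^sup>2 = real n + 2 * (z \<bullet> h) + (norm h)\<^sup>2" if "z \<in> binary_vectors E P" for z
  proof -
    have "(norm z)\<^sup>2 = real n"
      using binary_vectors_norm_sq[OF that] that assms by (simp add: binary_vectors_def)
    then show ?thesis
      by (simp add: power2_norm_eq_inner inner_add_left inner_add_right inner_commute)
  qed
  then show "(norm (a + h))\<^sup>2 < (norm (b + h))\<^sup>2 \<longleftrightarrow> a \<bullet> h < b \<bullet> h"
    if "a \<in> binary_vectors E P" "b \<in> binary_vectors E P" for a b
    using that by simp
qed

theorem proposition2p1:
  fixes G :: "'v::finite pair_pre_digraph"
    and X :: "(real ^ ('v set)) set"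
    and f :: "(real ^ ('v set)) \<times> (real ^ ('v set)) \<Rightarrow> real"
    and q :: nat
    and g :: "(real ^ ('v set)) \<times> (real ^ ('v set)) \<Rightarrow> nat \<Rightarrow> real"
    and \<rho> :: real
    and x w z \<mu> :: "nat \<Rightarrow> real ^ ('v set)"
    and D :: "'u::finite pair_pre_digraph"
    and r :: 'u
    and X' :: "(real ^ ('u \<times> 'u)) set"
    and f' :: "(real ^ ('u \<times> 'u)) \<times> (real ^ ('u \<times> 'u)) \<Rightarrow> real"
    and q' :: nat
    and g' :: "(real ^ ('u \<times> 'u)) \<times> (real ^ ('u \<times> 'u)) \<Rightarrow> nat \<Rightarrow> real"
    and \<rho>' :: real
    and x' w' z' \<mu>' :: "nat \<Rightarrow> real ^ ('u \<times> 'u)"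
  shows
    "(pair_pseudo_graph G \<and>
      centralized_admm (undirected_edges (parcs G)) (spanning_tree_vectors G) X f q g \<rho> x w z \<mu>
      \<longrightarrow> (\<forall>k. let h = \<mu> k - w (Suc k) in
             argmin_set (\<lambda>\<zeta>. (norm (\<zeta> - w (Suc k) + \<mu> k))\<^sup>2) (spanning_tree_vectors G) =
             argmin_set (\<lambda>\<zeta>. \<zeta> \<bullet> h) (spanning_tree_vectors G)))
     \<and>
     (pair_fin_digraph D \<and> r \<in> pverts D \<and>
      centralized_admm (parcs D) (arborescence_vectors D r) X' f' q' g' \<rho>' x' w' z' \<mu>'
      \<longrightarrow> (\<forall>k. let h = \<mu>' k - w' (Suc k) in
             argmin_set (\<lambda>\<zeta>. (norm (\<zeta> - w' (Suc k) + \<mu>' k))\<^sup>2) (arborescence_vectors D r) =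
             argmin_set (\<lambda>\<zeta>. \<zeta> \<bullet> h) (arborescence_vectors D r)))"
proof (intro conjI impI allI)
  fix k
  assume "pair_pseudo_graph G \<and>
    centralized_admm (undirected_edges (parcs G)) (spanning_tree_vectors G) X f q g \<rho> x w z \<mu>"
  then interpret pair_pseudo_graph G by blast
  show "let h = \<mu> k - w (Suc k) in
      argmin_set (\<lambda>\<zeta>. (norm (\<zeta> - w (Suc k) + \<mu> k))\<^sup>2) (spanning_tree_vectors G) =
      argmin_set (\<lambda>\<zeta>. \<zeta> \<bullet> h) (spanning_tree_vectors G)"
    \<comment> \<open>The constant cardinality is \<open>card (pverts G) - 1\<close>, and the vector
      in the norm regroups as \<open>\<zeta> + h\<close>.\<close>
    using argmin_set_norm_sq_eq_inner[OF is_spanning_tree_card, where h = "\<mu> k - w (Suc k)"]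
    by (simp add: spanning_tree_vectors_def algebra_simps)
next
  fix k
  assume "pair_fin_digraph D \<and> r \<in> pverts D \<and>
    centralized_admm (parcs D) (arborescence_vectors D r) X' f' q' g' \<rho>' x' w' z' \<mu>'"
  then interpret pair_fin_digraph D by blast
  show "let h = \<mu>' k - w' (Suc k) in
      argmin_set (\<lambda>\<zeta>. (norm (\<zeta> - w' (Suc k) + \<mu>' k))\<^sup>2) (arborescence_vectors D r) =
      argmin_set (\<lambda>\<zeta>. \<zeta> \<bullet> h) (arborescence_vectors D r)"
    using argmin_set_norm_sq_eq_inner[OF is_spanning_arborescence_card, where h = "\<mu>' k - w' (Suc k)"]
    by (simp add: arborescence_vectors_def algebra_simps)
qed

end
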